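(* Let $L$ be the line in $\mathbb{P}^2$ defined by $a_0x_0+a_1x_1+a_2x_2=0$, set $A=[a_0:a_1:a_2]$, and let $Q=[q_0:q_1:q_2]$, $Q'=[q_0':q_1':q_2']$ be two distinct points of $\mathbb{P}^2$. Suppose $A,Q,Q'\notin\Delta_0$. Then: (1) $Q\star L$ and $Q'\star L$ are both lines in each of the following cases: (a) $A\notin\Delta_1$ and either $Q\notin\Delta_1$ or $Q'\notin\Delta_1$; in this case the two lines are distinct; (b) $A\notin\Delta_1$ and $Q,Q'\in\Delta_1$; in this case the two lines are distinct if and only if $Q\star Q'\in\Delta_0$; (c) $A\in\Delta_1$ and $Q,Q'\notin\Delta_1$; in this case the two lines are distinct if and only if $\det\begin{pmatrix} q_j & q_k\\ q'_j & q'_k\end{pmatrix}\neq 0$, where $A\in H_i$ and $\{j,k\}=\{0,1,2\}\setminus\{i\}$; (d) $A\in\Delta_1$, $Q'\notin\Delta_1$ and $Q\star A\in\Delta_0$; in this case the two lines are distinct; (e) $A\in\Delta_1$, $Q\star A\in\Delta_0$ and $Q'\star A\in\Delta_0$; in this case the two lines are distinct if and only if $Q\star Q'\in\Delta_0$. (2) $Q\star L$ is a point and $Q'\star L$ is a line in each of the following cases: (a) $A,Q\in\Delta_1$, $Q'\notin\Delta_1$ and $Q\star A\notin\Delta_0$; in this case the point $Q\star L$ belongs to the line $Q'\star L$ if and only if $\det\begin{pmatrix} q_j & q_k\\ q'_j & q'_k\end{pmatrix}=0$, where $A\in H_i$ and $\{j,k\}=\{0,1,2\}\setminus\{i\}$;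 (b) $A,Q\in\Delta_1$, $Q\star A\notin\Delta_0$ and $Q'\star A\in\Delta_0$; in this case the point $Q\star L$ does not belong to the line $Q'\star L$. (3) $Q\star L$ and $Q'\star L$ are two distinct points when $A,Q,Q'\in\Delta_1$, $Q\star A\notin\Delta_0$ and $Q'\star A\notin\Delta_0$.
   Context: Work over an algebraically closed field $\mathbb{K}$; $\mathbb{P}^2$ is the projective plane with coordinates $x_0,x_1,x_2$. For points $P=[p_0:p_1:p_2]$, $Q=[q_0:q_1:q_2]$, the Hadamard product is $P\star Q=[p_0q_0:p_1q_1:p_2q_2]$, defined when not all $p_iq_i$ vanish. For a point $Q$ and a line $L$, $Q\star L$ is the Zariski closure of the set of all defined products $Q\star P$ with $P\in L$. $H_i$ is the line $x_i=0$. $\Delta_i$ is the set of points of $\mathbb{P}^2$ with at most $i+1$ nonzero coordinates ($\Delta_0$: the coordinate points; $\Delta_1$: the union of the coordinate lines). *)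

theory Defs
  imports
    "HOL-Analysis.Analysis"
    "HOL-Library.Poly_Mapping"
    "HOL-Computational_Algebra.Polynomial"
begin

text \<open>
  Coordinates are indexed by the three-element type \<open>3\<close>, whose elements are written
  \<open>0, 1, 2\<close> (so \<open>2 + 1 = 0\<close>, and the library's \<open>3\<close> is the same index as \<open>0\<close>).
\<close>

lemma UNIV_index: "(UNIV :: 3 set) = {0, 1, 2}"
  using UNIV_3 by auto

lemma forall_index: "(\<forall>i::3. P i) \<longleftrightarrow> P 0 \<and> P 1 \<and> P 2"
  by (metis UNIV_index UNIV_I insertE singletonD)

definition same_point :: "'a::field^3 \<Rightarrow> 'a^3 \<Rightarrow> bool" where
  "same_point v w \<longleftrightarrow> v \<noteq> 0 \<and> w \<noteq> 0 \<and> (\<exists>c. c \<noteq> 0 \<and> w = c *s v)"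

lemma part_equivp_same_point: "part_equivp (same_point :: 'a::field^3 \<Rightarrow> _)"
proof (rule part_equivpI)
  have "same_point (vec 1 :: 'a^3) (vec 1)"
    by (auto simp: same_point_def vec_eq_iff intro!: exI[of _ 1])
  then show "\<exists>x::'a^3. same_point x x" by blast
  show "symp (same_point :: 'a^3 \<Rightarrow> _)"
  proof (rule sympI)
    fix v w :: "'a^3" assume "same_point v w"
    then obtain c where "v \<noteq> 0" "w \<noteq> 0" "c \<noteq> 0" "w = c *s v"
      by (auto simp: same_point_def)
    then show "same_point w v"
      by (auto simp: same_point_def intro!: exI[of _ "inverse c"])
  qed
  show "transp (same_point :: 'a^3 \<Rightarrow> _)"
  proof (rule transpI)
    fix u v w :: "'a^3" assume "same_point u v" "same_point v w"
    then obtain c d where "u \<noteq> 0" "w \<noteq> 0" "c \<noteq> 0" "v = c *s u" "d \<noteq> 0" "w = d *s v"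
      by (auto simp: same_point_def)
    then show "same_point u w"
      by (auto simp: same_point_def intro!: exI[of _ "d * c"])
  qed
qed

text \<open>
  The projective plane.  For \<open>v \<noteq> 0\<close>, \<open>pt v\<close> is the point with homogeneous coordinates \<open>v\<close>;
  \<open>pt 0\<close> is meaningless.
\<close>

quotient_type (overloaded) 'a plane = "'a::field^3" / partial: same_point
  morphisms plane_rep pt
  by (rule part_equivp_same_point)

lemma pt_eq_iff:
  assumes "v \<noteq> 0" "w \<noteq> 0"
  shows "pt v = pt w \<longleftrightarrow> (\<exists>c. c \<noteq> 0 \<and> w = c *s v)"
proof -
  have refl: "same_point x x" if "x \<noteq> 0" for x :: "'a^3"
    using that by (auto simp: same_point_def intro!: exI[of _ 1])
  have "same_point v w \<longleftrightarrow> pt v = pt w"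
    using Quotient3_rel[OF Quotient3_plane, of v w] refl assms by blast
  then show ?thesis
    using assms by (auto simp: same_point_def)
qed

lemma plane_cases:
  obtains v where "v \<noteq> 0" "P = pt v"
proof -
  have "same_point (plane_rep P) (plane_rep P)" "pt (plane_rep P) = P"
    using Quotient3_rep_reflp[OF Quotient3_plane] Quotient3_abs_rep[OF Quotient3_plane] by auto
  then show ?thesis
    using that[of "plane_rep P"] by (auto simp: same_point_def)
qed

text \<open>
  Polynomials in the coordinates are finitely supported maps from exponents to coefficients.
\<close>

type_synonym 'a poly3 = "(3 \<Rightarrow>\<^sub>0 nat) \<Rightarrow>\<^sub>0 'a"

definition eval3 :: "'a::field poly3 \<Rightarrow> 'a^3 \<Rightarrow> 'a" where
  "eval3 p v = (\<Sum>m\<in>Poly_Mapping.keys p. poly_mapping.lookup p m * (\<Prod>i\<in>UNIV. (v $ i) ^ poly_mapping.lookup m i))"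

definition homogeneous :: "'a::field poly3 \<Rightarrow> bool" where
  "homogeneous p \<longleftrightarrow> (\<exists>d. \<forall>m\<in>Poly_Mapping.keys p. (\<Sum>i\<in>UNIV. poly_mapping.lookup m i) = d)"

definition zero_locus :: "'a::field poly3 set \<Rightarrow> 'a plane set" where
  "zero_locus F = {pt v | v. v \<noteq> 0 \<and> (\<forall>p\<in>F. eval3 p v = 0)}"

definition zariski_closed :: "'a::field plane set \<Rightarrow> bool" where
  "zariski_closed S \<longleftrightarrow> (\<exists>F. (\<forall>p\<in>F. homogeneous p) \<and> S = zero_locus F)"

definition zariski_closure :: "'a::field plane set \<Rightarrow> 'a plane set" where
  "zariski_closure S = zariski_closed hull S"

lemma eval3_scale:
  assumes "homogeneous p" "c \<noteq> 0"
  shows "eval3 p (c *s v) = 0 \<longleftrightarrow> eval3 p v = 0"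
proof -
  obtain d where d: "\<And>m. m \<in> Poly_Mapping.keys p \<Longrightarrow> (\<Sum>i\<in>UNIV. poly_mapping.lookup m i) = d"
    using assms(1) by (auto simp: homogeneous_def)
  have "eval3 p (c *s v) =
      (\<Sum>m\<in>Poly_Mapping.keys p. c ^ d * (poly_mapping.lookup p m * (\<Prod>i\<in>UNIV. (v $ i) ^ poly_mapping.lookup m i)))"
    unfolding eval3_def
    by (intro sum.cong refl)
      (simp add: power_mult_distrib prod.distrib power_sum[symmetric] d mult_ac)
  also have "\<dots> = c ^ d * eval3 p v"
    by (simp add: eval3_def sum_distrib_left)
  finally show ?thesis using assms(2) by simp
qed

text \<open>Membership in the zero locus does not depend on the chosen coordinates.\<close>

lemma pt_in_zero_locus_iff:
  assumes "\<forall>p\<in>F. homogeneous p" "v \<noteq> 0"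
  shows "pt v \<in> zero_locus F \<longleftrightarrow> (\<forall>p\<in>F. eval3 p v = 0)"
proof
  assume "pt v \<in> zero_locus F"
  then obtain w where w: "w \<noteq> 0" "pt v = pt w" "\<forall>p\<in>F. eval3 p w = 0"
    by (auto simp: zero_locus_def)
  then obtain c where "c \<noteq> 0" "w = c *s v"
    using pt_eq_iff assms(2) by metis
  then show "\<forall>p\<in>F. eval3 p v = 0"
    using w(3) assms(1) eval3_scale by blast
qed (use assms(2) in \<open>auto simp: zero_locus_def\<close>)

lemma zariski_closed_Inter:
  assumes "\<forall>S\<in>\<S>. zariski_closed S"
  shows "zariski_closed (\<Inter>\<S>)"
proof -
  obtain F where F: "\<And>S. S \<in> \<S> \<Longrightarrow> (\<forall>p\<in>F S. homogeneous p) \<and> S = zero_locus (F S)"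
    using assms unfolding zariski_closed_def by metis
  have hom: "\<forall>p\<in>\<Union>(F ` \<S>). homogeneous p" using F by blast
  have "P \<in> \<Inter>\<S> \<longleftrightarrow> P \<in> zero_locus (\<Union>(F ` \<S>))" for P
  proof -
    obtain v where v: "v \<noteq> 0" "P = pt v" by (rule plane_cases)
    have "P \<in> S \<longleftrightarrow> (\<forall>p\<in>F S. eval3 p v = 0)" if "S \<in> \<S>" for S
      using F[OF that] v pt_in_zero_locus_iff by metis
    then show ?thesis
      using pt_in_zero_locus_iff[OF hom v(1)] v(2) by auto
  qed
  then have "\<Inter>\<S> = zero_locus (\<Union>(F ` \<S>))" by blast
  with hom show ?thesis unfolding zariski_closed_def by blast
qed

lemma zariski_closed_zariski_closure: "zariski_closed (zariski_closure S)"
  unfolding zariski_closure_def by (rule hull_in) (rule zariski_closed_Inter)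

text \<open>
  The product of vectors in \<open>'a^3\<close> is the componentwise one.  Since \<open>v * w \<noteq> 0\<close> forces
  \<open>v \<noteq> 0\<close> and \<open>w \<noteq> 0\<close>, only genuine homogeneous coordinates occur below.  The value of
  \<open>P \<star> Q\<close> is unspecified where the Hadamard product is not defined.
\<close>

definition hadamard_defined :: "'a::field plane \<Rightarrow> 'a plane \<Rightarrow> bool" where
  "hadamard_defined P Q \<longleftrightarrow> (\<exists>p q. P = pt p \<and> Q = pt q \<and> p * q \<noteq> 0)"

definition hadamard :: "'a::field plane \<Rightarrow> 'a plane \<Rightarrow> 'a plane" (infixl \<open>\<star>\<close> 70) where
  "P \<star> Q = (THE R. \<exists>p q. P = pt p \<and> Q = pt q \<and> p * q \<noteq> 0 \<and> R = pt (p * q))"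

lemma hadamard_scale:
  fixes p q p' q' :: "'a::field^3"
  assumes "p \<noteq> 0" "q \<noteq> 0" "p' * q' \<noteq> 0" "pt p = pt p'" "pt q = pt q'"
  shows "p * q \<noteq> 0 \<and> pt (p * q) = pt (p' * q')"
proof -
  have nz: "p' \<noteq> 0" "q' \<noteq> 0" using assms(3) by (auto simp: vec_eq_iff)
  obtain c where c: "c \<noteq> 0" "p' = c *s p" using assms(4) pt_eq_iff[OF assms(1) nz(1)] by auto
  obtain d where d: "d \<noteq> 0" "q' = d *s q" using assms(5) pt_eq_iff[OF assms(2) nz(2)] by auto
  have eq: "p' * q' = (c * d) *s (p * q)" using c d by (simp add: vec_eq_iff)
  then have "p * q \<noteq> 0" using assms(3) by auto
  moreover have "pt (p * q) = pt (p' * q')"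
    using pt_eq_iff[OF \<open>p * q \<noteq> 0\<close> assms(3)] eq c d by (auto intro!: exI[of _ "c * d"])
  ultimately show ?thesis by simp
qed

lemma hadamard_defined_pt:
  assumes "p \<noteq> 0" "q \<noteq> 0"
  shows "hadamard_defined (pt p) (pt q) \<longleftrightarrow> p * q \<noteq> 0"
  using hadamard_scale[OF assms] unfolding hadamard_defined_def by blast

lemma hadamard_pt:
  assumes "p * q \<noteq> 0"
  shows "pt p \<star> pt q = pt (p * q)"
proof -
  have "p \<noteq> 0" "q \<noteq> 0" using assms by (auto simp: vec_eq_iff)
  then show ?thesis
    unfolding hadamard_def using assms hadamard_scale[of p q] by (intro the_equality) metis+
qed

definition hadamard_set :: "'a::field plane \<Rightarrow> 'a plane set \<Rightarrow> 'a plane set"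
    (infixl \<open>\<star>\<^sub>s\<close> 70) where
  "Q \<star>\<^sub>s L = zariski_closure {Q \<star> P | P. P \<in> L \<and> hadamard_defined Q P}"

text \<open>The zero set of \<open>b\<^sub>0 x\<^sub>0 + b\<^sub>1 x\<^sub>1 + b\<^sub>2 x\<^sub>2\<close>; a line when \<open>b \<noteq> 0\<close>.\<close>

definition line :: "'a::field^3 \<Rightarrow> 'a plane set" where
  "line b = {pt x | x. x \<noteq> 0 \<and> b $ 0 * x $ 0 + b $ 1 * x $ 1 + b $ 2 * x $ 2 = 0}"

definition is_line :: "'a::field plane set \<Rightarrow> bool" where
  "is_line S \<longleftrightarrow> (\<exists>b. b \<noteq> 0 \<and> S = line b)"

definition coord_line :: "3 \<Rightarrow> 'a::field plane set" (\<open>H\<close>) where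
  "H i = {pt x | x. x \<noteq> 0 \<and> x $ i = 0}"

definition Delta :: "nat \<Rightarrow> 'a::field plane set" (\<open>\<Delta>\<close>) where
  "\<Delta> n = {pt x | x. x \<noteq> 0 \<and> card {j. x $ j \<noteq> 0} \<le> n + 1}"

end

theory Submission
  imports Defs
begin

text \<open>
  Let \<open>q\<close> and \<open>a\<close> be coordinates of \<open>Q\<close> and \<open>A\<close>, and let \<open>b = (a\<^sub>0 q\<^sub>1 q\<^sub>2, a\<^sub>1 q\<^sub>0 q\<^sub>2, a\<^sub>2 q\<^sub>0 q\<^sub>1)\<close>.
  For every \<open>x\<close> the value of the linear form \<open>b\<close> at the componentwise product \<open>q * x\<close> is
  \<open>q\<^sub>0 q\<^sub>1 q\<^sub>2 (a\<^sub>0 x\<^sub>0 + a\<^sub>1 x\<^sub>1 + a\<^sub>2 x\<^sub>2)\<close>, so all products of \<open>Q\<close> with points of \<open>L\<close> lie on the zero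
  set of \<open>b\<close>.  If \<open>b \<noteq> 0\<close>, every point of that line is such a product
  (\<open>hadamard_line_eq_line\<close>).  If \<open>b = 0\<close>, then \<open>a\<close> and \<open>q\<close> vanish at the same
  coordinate: \<open>L\<close> passes through a coordinate point, and multiplication by \<open>Q\<close> is, up to a
  scaling of the coordinates, the projection from it, which contracts \<open>L\<close> to a single point
  (\<open>hadamard_line_eq_point\<close>).  Both images are already Zariski closed.

  Whether the images of \<open>L\<close> under \<open>Q\<close> and \<open>Q'\<close> agree is a question about proportional vectors,
  that is, about vanishing \<open>2 \<times> 2\<close> minors.  The minors of the two forms are, up to sign, the
  products \<open>a\<^sub>j a\<^sub>k q\<^sub>i q'\<^sub>i (q\<^sub>j q'\<^sub>k - q\<^sub>k q'\<^sub>j)\<close> with \<open>{i, j, k} = {0, 1, 2}\<close>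
  (\<open>image_form_minors\<close>).  A point outside \<open>\<Delta> 0\<close> has at most one zero coordinate, so
  everything depends on where the zeros of \<open>a\<close>, \<open>q\<close> and \<open>q'\<close> are.  The conditions
  of the theorem describe just this: for \<open>A \<in> \<Delta> 1\<close>, the product of \<open>Q\<close> and \<open>A\<close> lies in \<open>\<Delta> 0\<close>
  if and only if \<open>q\<close> has a zero at another place than \<open>a\<close>
  (\<open>hadamard_in_Delta0_iff_image_form\<close>).
\<close>

section \<open>Points and lines of the plane in coordinates\<close>

lemma vec3_eq_iff: "(v::'a^3) = w \<longleftrightarrow> v $ 0 = w $ 0 \<and> v $ 1 = w $ 1 \<and> v $ 2 = w $ 2"
  by (simp add: vec_eq_iff forall_index)

lemma index_numerals: "(3 :: 3) = 0" "(4 :: 3) = 1"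
  by simp_all

lemma index_cases: "i = 0 \<or> i = 1 \<or> i = (2 :: 3)"
  using UNIV_index by blast

lemma complement_index:
  assumes "{j, k} = {0, 1, 2} - {i :: 3}"
  shows "j \<noteq> i" "k \<noteq> i" "j \<noteq> k"
proof -
  have "j \<in> {0, 1, 2} - {i}" "k \<in> {0, 1, 2} - {i}"
    unfolding assms[symmetric] by simp_all
  then show "j \<noteq> i" "k \<noteq> i"
    by simp_all
  show "j \<noteq> k"
  proof
    assume jk: "j = k"
    have "m \<in> {j, k} \<or> m = i" for m
      unfolding assms using index_cases[of m] by simp
    then have "m = j \<or> m = i" for m
      unfolding jk by simp
    from this[of 0] this[of 1] this[of 2] show False
      by (elim disjE) simp_all
  qed
qed

lemma sum_index: "(\<Sum>i\<in>(UNIV :: 3 set). f i) = f 0 + f 1 + f 2"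
  by (simp only: sum_3 index_numerals ac_simps)

lemma minors_index:
  fixes v w :: "'a::comm_semiring_1^3"
  shows "(\<forall>i j. v $ i * w $ j = v $ j * w $ i) \<longleftrightarrow>
    v $ 0 * w $ 1 = v $ 1 * w $ 0 \<and> v $ 0 * w $ 2 = v $ 2 * w $ 0 \<and> v $ 1 * w $ 2 = v $ 2 * w $ 1"
  by (auto simp: forall_index)

text \<open>Where \<open>v\<close> has a nonzero coordinate, the quotient of the two coordinates is the factor of
  proportionality.\<close>
lemma pt_eq_iff_minors:
  assumes "v \<noteq> 0" "w \<noteq> 0"
  shows "pt v = pt w \<longleftrightarrow> (\<forall>i j. v $ i * w $ j = v $ j * w $ i)"
proof
  assume "pt v = pt w"
  then show "\<forall>i j. v $ i * w $ j = v $ j * w $ i"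
    using assms by (auto simp: pt_eq_iff)
next
  assume minors: "\<forall>i j. v $ i * w $ j = v $ j * w $ i"
  obtain m where m: "v $ m \<noteq> 0"
    using assms(1) by (auto simp: vec_eq_iff)
  have "w = (w $ m / v $ m) *s v"
    using m minors by (simp add: vec_eq_iff field_simps)
  moreover from this have "w $ m / v $ m \<noteq> 0"
    using assms(2) by auto
  ultimately show "pt v = pt w"
    using assms pt_eq_iff by blast
qed

lemma pt_in_line_iff:
  assumes "x \<noteq> 0"
  shows "pt x \<in> line b \<longleftrightarrow> b $ 0 * x $ 0 + b $ 1 * x $ 1 + b $ 2 * x $ 2 = 0"
proof
  assume "pt x \<in> line b"
  then obtain y where y: "y \<noteq> 0" "pt x = pt y" "b $ 0 * y $ 0 + b $ 1 * y $ 1 + b $ 2 * y $ 2 = 0"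
    by (auto simp: line_def)
  then obtain c where "c \<noteq> 0" "y = c *s x"
    using assms pt_eq_iff by blast
  moreover from this have "c * (b $ 0 * x $ 0 + b $ 1 * x $ 1 + b $ 2 * x $ 2) = 0"
    using y(3) by (simp add: algebra_simps)
  ultimately show "b $ 0 * x $ 0 + b $ 1 * x $ 1 + b $ 2 * x $ 2 = 0"
    by simp
qed (use assms in \<open>auto simp: line_def\<close>)

lemma line_eqI:
  assumes "\<And>x. x \<noteq> 0 \<Longrightarrow> pt x \<in> S \<longleftrightarrow> b $ 0 * x $ 0 + b $ 1 * x $ 1 + b $ 2 * x $ 2 = 0"
  shows "S = line b"
proof (intro set_eqI)
  fix P show "P \<in> S \<longleftrightarrow> P \<in> line b"
    by (cases P rule: plane_cases) (simp add: assms pt_in_line_iff)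
qed

text \<open>A vector annihilated by everything that annihilates \<open>v\<close> is proportional to \<open>v\<close>: the vectors
  \<open>(v\<^sub>1, -v\<^sub>0, 0)\<close>, \<open>(v\<^sub>2, 0, -v\<^sub>0)\<close> and \<open>(0, v\<^sub>2, -v\<^sub>1)\<close> give the three minors.  This serves both to
  recover a line's equation from its points and to cut out a point by the lines through it.\<close>
lemma minors_of_orthogonal:
  fixes v w :: "'a::field^3"
  assumes orth: "\<And>x :: 'a^3. v $ 0 * x $ 0 + v $ 1 * x $ 1 + v $ 2 * x $ 2 = 0 \<Longrightarrow>
    w $ 0 * x $ 0 + w $ 1 * x $ 1 + w $ 2 * x $ 2 = 0"
  shows "v $ i * w $ j = v $ j * w $ i"
proof -
  have "v $ 0 * w $ 1 = v $ 1 * w $ 0"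
    using orth[of "\<chi> i. if i = 0 then v $ 1 else if i = 1 then - v $ 0 else 0"]
    by (simp add: algebra_simps)
  moreover have "v $ 0 * w $ 2 = v $ 2 * w $ 0"
    using orth[of "\<chi> i. if i = 0 then v $ 2 else if i = 2 then - v $ 0 else 0"]
    by (simp add: algebra_simps)
  moreover have "v $ 1 * w $ 2 = v $ 2 * w $ 1"
    using orth[of "\<chi> i. if i = 1 then v $ 2 else if i = 2 then - v $ 1 else 0"]
    by (simp add: algebra_simps)
  ultimately have "\<forall>i j. v $ i * w $ j = v $ j * w $ i"
    by (simp add: forall_index)
  then show ?thesis by blast
qed

lemma line_eq_iff:
  fixes b c :: "'a::field^3"
  assumes "b \<noteq> 0" "c \<noteq> 0"
  shows "line b = line c \<longleftrightarrow> pt b = pt c"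
proof
  assume eq: "line b = line c"
  have "c $ 0 * x $ 0 + c $ 1 * x $ 1 + c $ 2 * x $ 2 = 0"
    if "b $ 0 * x $ 0 + b $ 1 * x $ 1 + b $ 2 * x $ 2 = 0" for x :: "'a^3"
    using that eq pt_in_line_iff[of x b] pt_in_line_iff[of x c] by (cases "x = 0") auto
  then show "pt b = pt c"
    using pt_eq_iff_minors[OF assms] minors_of_orthogonal by blast
next
  assume "pt b = pt c"
  then obtain t where "t \<noteq> 0" "c = t *s b"
    using assms pt_eq_iff by metis
  moreover from this have
    "c $ 0 * x $ 0 + c $ 1 * x $ 1 + c $ 2 * x $ 2 = t * (b $ 0 * x $ 0 + b $ 1 * x $ 1 + b $ 2 * x $ 2)"
    for x :: "'a^3"
    by (simp add: algebra_simps)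
  ultimately show "line b = line c"
    by (intro line_eqI) (metis pt_in_line_iff mult_eq_0_iff)
qed

section \<open>Lines and points are Zariski closed\<close>

definition linear_form :: "'a::field^3 \<Rightarrow> 'a poly3" where
  "linear_form b = (\<Sum>i\<in>UNIV. Poly_Mapping.single (Poly_Mapping.single i 1) (b $ i))"

lemma lookup_linear_form:
  "poly_mapping.lookup (linear_form b) (Poly_Mapping.single i 1) = b $ i"
proof -
  have "poly_mapping.lookup (linear_form b) (Poly_Mapping.single i 1) =
     (\<Sum>k\<in>UNIV. if k = i then b $ k else 0)"
    \<comment> \<open>Two of the monomials with different variables differ since their supports do.\<close>
    unfolding linear_form_def lookup_sum
    by (intro sum.cong refl) (auto simp: lookup_single when_def dest: arg_cong[where f=Poly_Mapping.keys])
  then show ?thesis by simp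
qed

lemma keys_linear_form: "Poly_Mapping.keys (linear_form b) \<subseteq> range (\<lambda>i. Poly_Mapping.single i 1)"
  unfolding linear_form_def by (rule order.trans[OF Poly_Mapping.keys_sum]) auto

lemma homogeneous_linear_form: "homogeneous (linear_form b)"
  unfolding homogeneous_def
  using keys_linear_form[of b] by (intro exI[of _ 1]) (auto simp: lookup_single when_def)

lemma eval3_linear_form: "eval3 (linear_form b) x = (\<Sum>i\<in>UNIV. b $ i * x $ i)"
proof -
  let ?m = "\<lambda>i::3. Poly_Mapping.single i (1::nat)"
  have inj: "inj ?m"
    by (auto intro!: injI dest: arg_cong[where f=Poly_Mapping.keys])
  have "eval3 (linear_form b) x =
      (\<Sum>m\<in>range ?m. poly_mapping.lookup (linear_form b) m * (\<Prod>i\<in>UNIV. (x $ i) ^ poly_mapping.lookup m i))"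
    unfolding eval3_def using keys_linear_form[of b]
    by (intro sum.mono_neutral_left) (auto simp: in_keys_iff)
  also have "\<dots> = (\<Sum>i\<in>UNIV. b $ i * (\<Prod>k\<in>UNIV. (x $ k) ^ poly_mapping.lookup (?m i) k))"
    using inj by (simp add: sum.reindex lookup_linear_form[simplified])
  also have "\<dots> = (\<Sum>i\<in>UNIV. b $ i * (\<Prod>k\<in>UNIV. if k = i then x $ k else 1))"
    by (intro sum.cong refl arg_cong2[where f="(*)"] prod.cong) (auto simp: lookup_single when_def)
  finally show ?thesis by simp
qed

lemma zariski_closed_line: "zariski_closed (line b)"
proof -
  have "zero_locus {linear_form b} = line b"
    unfolding zero_locus_def line_def by (simp only: ball_simps eval3_linear_form sum_index simp_thms)
  then show ?thesis
    unfolding zariski_closed_def using homogeneous_linear_form by blast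
qed

text \<open>A point is the intersection of all lines through it, and lines are closed.\<close>
lemma zariski_closed_point: "zariski_closed {P :: 'a::field plane}"
proof -
  obtain v where v: "v \<noteq> 0" "P = pt v" by (rule plane_cases)
  let ?B = "{b. v $ 0 * b $ 0 + v $ 1 * b $ 1 + v $ 2 * b $ 2 = 0}"
  have "R \<in> \<Inter> (line ` ?B) \<longleftrightarrow> R = P" for R
  proof
    assume R: "R \<in> \<Inter> (line ` ?B)"
    obtain w where w: "w \<noteq> 0" "R = pt w" by (rule plane_cases)
    have "w $ 0 * b $ 0 + w $ 1 * b $ 1 + w $ 2 * b $ 2 = 0" if "b \<in> ?B" for b :: "'a^3"
      using that R w pt_in_line_iff[of w b] by (auto simp: mult.commute)
    then show "R = P"
      using v w pt_eq_iff_minors[OF v(1) w(1)] minors_of_orthogonal[of v w] by simp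
  qed (auto simp: v pt_in_line_iff mult.commute)
  then have "{P} = \<Inter> (line ` ?B)" by blast
  then show ?thesis
    using zariski_closed_Inter[of "line ` ?B"] zariski_closed_line by auto
qed

lemma zariski_closure_closed: "zariski_closed S \<Longrightarrow> zariski_closure S = S"
  unfolding zariski_closure_def by (rule hull_same)

section \<open>Vanishing coordinates\<close>

lemma pt_eq_imp_zero_coord_iff:
  assumes "pt v = pt w" "v \<noteq> 0" "w \<noteq> 0"
  shows "v $ i = 0 \<longleftrightarrow> w $ i = 0"
proof -
  obtain c where "c \<noteq> 0" "w = c *s v"
    using assms pt_eq_iff by blast
  then show ?thesis by simp
qed

lemma pt_in_Delta_iff:
  assumes "v \<noteq> 0"
  shows "pt v \<in> \<Delta> n \<longleftrightarrow> card {j. v $ j \<noteq> 0} \<le> n + 1"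
proof
  assume "pt v \<in> \<Delta> n"
  then obtain w where "w \<noteq> 0" "pt v = pt w" "card {j. w $ j \<noteq> 0} \<le> n + 1"
    unfolding Delta_def by blast
  then show "card {j. v $ j \<noteq> 0} \<le> n + 1"
    using assms pt_eq_imp_zero_coord_iff[of v w] by simp
next
  assume "card {j. v $ j \<noteq> 0} \<le> n + 1"
  then show "pt v \<in> \<Delta> n"
    using assms unfolding Delta_def by blast
qed

lemma pt_in_coord_line_iff:
  assumes "v \<noteq> 0"
  shows "pt v \<in> H i \<longleftrightarrow> v $ i = 0"
  using assms pt_eq_imp_zero_coord_iff unfolding coord_line_def by blast

lemma card_nonzero:
  "card {j. (v::'a::zero^3) $ j \<noteq> 0} =
    (if v $ 0 = 0 then 0 else 1) + (if v $ 1 = 0 then 0 else 1) + (if v $ 2 = 0 then 0 else 1)"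
proof -
  have "{j. v $ j \<noteq> 0} = (if v $ 0 = 0 then {} else {0}) \<union> (if v $ 1 = 0 then {} else {1}) \<union>
      (if v $ 2 = 0 then {} else {2})"
    unfolding set_eq_iff forall_index by simp
  then show ?thesis by (simp only:) simp
qed

lemma pt_in_Delta0_iff:
  assumes "v \<noteq> 0"
  shows "pt v \<in> \<Delta> 0 \<longleftrightarrow> v $ 0 * v $ 1 = 0 \<and> v $ 0 * v $ 2 = 0 \<and> v $ 1 * v $ 2 = 0"
  unfolding pt_in_Delta_iff[OF assms] card_nonzero
  by simp

lemma pt_in_Delta1_iff:
  assumes "v \<noteq> 0"
  shows "pt v \<in> \<Delta> 1 \<longleftrightarrow> v $ 0 = 0 \<or> v $ 1 = 0 \<or> v $ 2 = 0"
  unfolding pt_in_Delta_iff[OF assms] card_nonzero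
  by simp

lemma two_nonzero_coords:
  assumes "v \<noteq> 0" "pt v \<notin> \<Delta> 0"
  shows "v $ 0 \<noteq> 0 \<or> v $ 1 \<noteq> 0" "v $ 0 \<noteq> 0 \<or> v $ 2 \<noteq> 0" "v $ 1 \<noteq> 0 \<or> v $ 2 \<noteq> 0"
  using assms by (auto simp: pt_in_Delta0_iff)

lemma unique_zero_coord:
  assumes "v \<noteq> 0" "pt v \<notin> \<Delta> 0" "pt v \<in> \<Delta> 1"
  shows "v $ 0 = 0 \<and> v $ 1 \<noteq> 0 \<and> v $ 2 \<noteq> 0 \<or> v $ 0 \<noteq> 0 \<and> v $ 1 = 0 \<and> v $ 2 \<noteq> 0 \<or>
    v $ 0 \<noteq> 0 \<and> v $ 1 \<noteq> 0 \<and> v $ 2 = 0"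
  using two_nonzero_coords[OF assms(1,2)] assms(3) unfolding pt_in_Delta1_iff[OF assms(1)] by blast

lemma hadamard_in_Delta0_iff:
  assumes "v \<noteq> 0" "pt v \<notin> \<Delta> 0" "w \<noteq> 0" "pt w \<notin> \<Delta> 0"
  shows "pt v \<star> pt w \<in> \<Delta> 0 \<longleftrightarrow>
    (v $ 0 * v $ 1 = 0 \<or> w $ 0 * w $ 1 = 0) \<and> (v $ 0 * v $ 2 = 0 \<or> w $ 0 * w $ 2 = 0) \<and>
    (v $ 1 * v $ 2 = 0 \<or> w $ 1 * w $ 2 = 0)"
proof -
  \<comment> \<open>Two pairs out of three indices overlap, so the product is defined.\<close>
  have nz: "v * w \<noteq> 0"
    using two_nonzero_coords[OF assms(1,2)] two_nonzero_coords[OF assms(3,4)]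
    by (auto simp: vec3_eq_iff)
  show ?thesis
    unfolding hadamard_pt[OF nz] pt_in_Delta0_iff[OF nz] by auto
qed

section \<open>The form that vanishes on the products\<close>

text \<open>Index arithmetic is modulo 3, so \<open>i + 1\<close> and \<open>i + 2\<close> are the two indices other than \<open>i\<close>.
  Where \<open>q\<close> has no zero, this is \<open>(a\<^sub>0 / q\<^sub>0, a\<^sub>1 / q\<^sub>1, a\<^sub>2 / q\<^sub>2)\<close> up to a factor; without denominators
  it also covers a \<open>q\<close> with a zero coordinate.\<close>
definition image_form :: "'a::field^3 \<Rightarrow> 'a^3 \<Rightarrow> 'a^3" where
  "image_form q a = (\<chi> i. a $ i * q $ (i + 1) * q $ (i + 2))"

lemma image_form_coord:
  "image_form q a $ 0 = a $ 0 * q $ 1 * q $ 2"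
  "image_form q a $ 1 = a $ 1 * q $ 0 * q $ 2"
  "image_form q a $ 2 = a $ 2 * q $ 0 * q $ 1"
  by (simp_all add: image_form_def index_numerals mult.assoc mult.commute[of "q $ 2"])

text \<open>A zero of \<open>q\<close> kills two of the coefficients, and the third one is zero only if \<open>a\<close> vanishes at
  that coordinate too.  Geometrically, the line with coefficients \<open>a\<close> then passes through the one
  coordinate point that has no product with \<open>q\<close>.\<close>
lemma image_form_eq_0_iff:
  assumes "a \<noteq> 0" "pt a \<notin> \<Delta> 0" "q \<noteq> 0" "pt q \<notin> \<Delta> 0"
  shows "image_form q a = 0 \<longleftrightarrow>
    a $ 0 = 0 \<and> q $ 0 = 0 \<or> a $ 1 = 0 \<and> q $ 1 = 0 \<or> a $ 2 = 0 \<and> q $ 2 = 0"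
  using two_nonzero_coords[OF assms(1,2)] two_nonzero_coords[OF assms(3,4)]
  by (auto simp: vec3_eq_iff image_form_coord)

text \<open>With exactly one zero in \<open>a\<close>, the product \<open>q * a\<close> has a second zero only when \<open>q\<close> vanishes at
  another coordinate, and then the image of the line is not contracted.\<close>
lemma hadamard_in_Delta0_iff_image_form:
  assumes "a \<noteq> 0" "pt a \<notin> \<Delta> 0" "pt a \<in> \<Delta> 1" "q \<noteq> 0" "pt q \<notin> \<Delta> 0"
  shows "pt q \<star> pt a \<in> \<Delta> 0 \<longleftrightarrow> pt q \<in> \<Delta> 1 \<and> image_form q a \<noteq> 0"
  using unique_zero_coord[OF assms(1-3)] two_nonzero_coords[OF assms(4,5)]
  unfolding hadamard_in_Delta0_iff[OF assms(4,5,1,2)] pt_in_Delta1_iff[OF assms(4)]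
    image_form_eq_0_iff[OF assms(1,2,4,5)]
  by (elim disjE conjE) auto

text \<open>Every minor of the two forms is a minor of \<open>q\<close> and \<open>q'\<close> times a monomial, whose vanishing can be
  read off the zeros of the three vectors.\<close>
lemma image_form_minors:
  fixes a q q' :: "'a::field^3"
  shows
  "(\<forall>i j. image_form q a $ i * image_form q' a $ j = image_form q a $ j * image_form q' a $ i) \<longleftrightarrow>
    (a $ 1 * a $ 2 * q $ 0 * q' $ 0 = 0 \<or> q $ 1 * q' $ 2 = q $ 2 * q' $ 1) \<and>
    (a $ 0 * a $ 2 * q $ 1 * q' $ 1 = 0 \<or> q $ 0 * q' $ 2 = q $ 2 * q' $ 0) \<and>
    (a $ 0 * a $ 1 * q $ 2 * q' $ 2 = 0 \<or> q $ 0 * q' $ 1 = q $ 1 * q' $ 0)"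
proof -
  have minors: "image_form q a $ 2 * image_form q' a $ 1 - image_form q a $ 1 * image_form q' a $ 2 =
      a $ 1 * a $ 2 * q $ 0 * q' $ 0 * (q $ 1 * q' $ 2 - q $ 2 * q' $ 1)"
    "image_form q a $ 2 * image_form q' a $ 0 - image_form q a $ 0 * image_form q' a $ 2 =
      a $ 0 * a $ 2 * q $ 1 * q' $ 1 * (q $ 0 * q' $ 2 - q $ 2 * q' $ 0)"
    "image_form q a $ 1 * image_form q' a $ 0 - image_form q a $ 0 * image_form q' a $ 1 =
      a $ 0 * a $ 1 * q $ 2 * q' $ 2 * (q $ 0 * q' $ 1 - q $ 1 * q' $ 0)"
    by (simp_all add: image_form_coord algebra_simps)
  \<comment> \<open>The equations become differences, to which the factorizations apply.\<close>
  have crit: "(\<forall>i j. b $ i * c $ j = b $ j * c $ i) \<longleftrightarrow>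
      b $ 2 * c $ 1 - b $ 1 * c $ 2 = 0 \<and> b $ 2 * c $ 0 - b $ 0 * c $ 2 = 0 \<and>
      b $ 1 * c $ 0 - b $ 0 * c $ 1 = 0"
    for b c :: "'a^3"
    by (auto simp: forall_index)
  show ?thesis
    unfolding crit minors by (simp only: mult_eq_0_iff right_minus_eq disj_assoc)
qed

section \<open>The product of a point and a line\<close>

lemma hadamard_set_pt_line:
  assumes "q \<noteq> 0"
  shows "pt q \<star>\<^sub>s line a = zariski_closure
    {pt (q * x) | x. q * x \<noteq> 0 \<and> a $ 0 * x $ 0 + a $ 1 * x $ 1 + a $ 2 * x $ 2 = 0}"
    (is "_ = zariski_closure ?T")
proof -
  have "{pt q \<star> P | P. P \<in> line a \<and> hadamard_defined (pt q) P} = ?T" (is "?S = ?T")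
  proof (intro set_eqI iffI)
    fix R assume "R \<in> ?S"
    then obtain x where x: "x \<noteq> 0" "a $ 0 * x $ 0 + a $ 1 * x $ 1 + a $ 2 * x $ 2 = 0"
        "hadamard_defined (pt q) (pt x)" "R = pt q \<star> pt x"
      by (auto simp: line_def)
    then show "R \<in> ?T"
      using assms hadamard_defined_pt hadamard_pt by blast
  next
    fix R assume "R \<in> ?T"
    then obtain x where x: "q * x \<noteq> 0" "a $ 0 * x $ 0 + a $ 1 * x $ 1 + a $ 2 * x $ 2 = 0"
        "R = pt (q * x)"
      by blast
    moreover from x(1) have "x \<noteq> 0" by auto
    ultimately show "R \<in> ?S"
      using assms hadamard_defined_pt[of q x] hadamard_pt[of q x] pt_in_line_iff[of x a]
      by (intro CollectI exI[of _ "pt x"]) simp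
  qed
  then show ?thesis by (simp add: hadamard_set_def)
qed

text \<open>Away from zeros of \<open>q\<close>, a point of the image line is divided by \<open>q\<close>.  If \<open>q\<^sub>i = 0\<close>, the form is a
  multiple of the \<open>i\<close>-th coordinate with \<open>a\<^sub>i \<noteq> 0\<close>; the \<open>i\<close>-th coordinate of a preimage is then free,
  and the equation of the given line determines it.\<close>
lemma hadamard_line_eq_line:
  assumes "image_form q a \<noteq> 0"
  shows "pt q \<star>\<^sub>s line a = line (image_form q a)"
proof -
  have "q \<noteq> 0"
    using assms by (auto simp: vec3_eq_iff image_form_coord)
  have "{pt (q * x) | x. q * x \<noteq> 0 \<and> a $ 0 * x $ 0 + a $ 1 * x $ 1 + a $ 2 * x $ 2 = 0}
     = line (image_form q a)" (is "?T = _")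
  proof (intro set_eqI iffI)
    fix R assume "R \<in> ?T"
    then obtain x where x: "q * x \<noteq> 0" "a $ 0 * x $ 0 + a $ 1 * x $ 1 + a $ 2 * x $ 2 = 0"
        "R = pt (q * x)"
      by blast
    have "image_form q a $ 0 * (q * x) $ 0 + image_form q a $ 1 * (q * x) $ 1 + image_form q a $ 2 * (q * x) $ 2 =
        q $ 0 * q $ 1 * q $ 2 * (a $ 0 * x $ 0 + a $ 1 * x $ 1 + a $ 2 * x $ 2)"
      by (simp add: image_form_coord algebra_simps)
    with x show "R \<in> line (image_form q a)"
      by (simp add: pt_in_line_iff)
  next
    fix R assume R: "R \<in> line (image_form q a)"
    obtain y where y: "y \<noteq> 0" "R = pt y" by (rule plane_cases)
    with R have y0:
      "a $ 0 * q $ 1 * q $ 2 * y $ 0 + a $ 1 * q $ 0 * q $ 2 * y $ 1 + a $ 2 * q $ 0 * q $ 1 * y $ 2 = 0"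
      by (simp add: pt_in_line_iff image_form_coord)
    have "\<exists>x. a $ 0 * x $ 0 + a $ 1 * x $ 1 + a $ 2 * x $ 2 = 0 \<and> q * x = y"
    proof (cases "q $ 0 * q $ 1 * q $ 2 = 0")
      case False
      then show ?thesis
        using y0 by (intro exI[of _ "\<chi> i. y $ i / q $ i"]) (auto simp: vec3_eq_iff field_simps)
    next
      case True
      then obtain i where qi: "q $ i = 0" by auto
      have b: "a $ 0 * q $ 1 * q $ 2 \<noteq> 0 \<or> a $ 1 * q $ 0 * q $ 2 \<noteq> 0 \<or> a $ 2 * q $ 0 * q $ 1 \<noteq> 0"
        using assms by (auto simp: vec3_eq_iff image_form_coord)
      \<comment> \<open>Division by zero makes \<open>d $ i = 0\<close>, so that the sum below runs over the other two indices.\<close>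
      define d where "d = (\<chi> j. y $ j / q $ j)"
      define x where "x = (\<chi> j. if j = i then - (\<Sum>k\<in>UNIV. a $ k * d $ k) / a $ i else d $ j)"
      show ?thesis
        using index_cases[of i] qi b y0
        by (intro exI[of _ x]) (elim disjE; simp add: x_def d_def vec3_eq_iff sum_index)
    qed
    then show "R \<in> ?T" using y by auto
  qed
  then show ?thesis
    using \<open>q \<noteq> 0\<close> by (simp add: hadamard_set_pt_line zariski_closure_closed zariski_closed_line)
qed

text \<open>The cross product of \<open>a\<close> and \<open>(1, 1, 1)\<close> is orthogonal to \<open>a\<close>, hence gives a point of the line
  with coefficients \<open>a\<close>.  If \<open>a\<close> has its only zero at \<open>i\<close>, the other two coordinates of the cross
  product do not vanish, so this point is not the \<open>i\<close>-th coordinate point and its product with a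
  \<open>q\<close> that also vanishes only at \<open>i\<close> is defined.\<close>
definition image_point :: "'a::field^3 \<Rightarrow> 'a^3 \<Rightarrow> 'a^3" where
  "image_point q a = q * (\<chi> i. a $ (i + 1) - a $ (i + 2))"

lemma image_point_coord:
  "image_point q a $ 0 = q $ 0 * (a $ 1 - a $ 2)"
  "image_point q a $ 1 = q $ 1 * (a $ 2 - a $ 0)"
  "image_point q a $ 2 = q $ 2 * (a $ 0 - a $ 1)"
  by (simp_all add: image_point_def index_numerals)

text \<open>If \<open>a\<^sub>i = q\<^sub>i = 0\<close>, the equation of the line fixes the ratio of the other two coordinates, and
  multiplication by \<open>q\<close> forgets the \<open>i\<close>-th one.\<close>
lemma hadamard_line_eq_point:
  assumes "a \<noteq> 0" "pt a \<notin> \<Delta> 0" "q \<noteq> 0" "pt q \<notin> \<Delta> 0" "image_form q a = 0"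
  shows "image_point q a \<noteq> 0" "pt q \<star>\<^sub>s line a = {pt (image_point q a)}"
proof -
  note nz = two_nonzero_coords[OF assms(1,2)] two_nonzero_coords[OF assms(3,4)]
  have zero: "a $ 0 = 0 \<and> q $ 0 = 0 \<or> a $ 1 = 0 \<and> q $ 1 = 0 \<or> a $ 2 = 0 \<and> q $ 2 = 0"
    using assms(5) unfolding image_form_eq_0_iff[OF assms(1-4)] .
  have "image_point q a $ 0 \<noteq> 0 \<or> image_point q a $ 1 \<noteq> 0"
    using zero nz unfolding image_point_coord by (elim disjE conjE) simp_all
  then show p: "image_point q a \<noteq> 0" by auto
  have "{pt (q * x) | x. q * x \<noteq> 0 \<and> a $ 0 * x $ 0 + a $ 1 * x $ 1 + a $ 2 * x $ 2 = 0}
     = {pt (image_point q a)}" (is "?T = _")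
  proof -
    have "pt (q * x) = pt (image_point q a)"
      if "q * x \<noteq> 0" and x: "a $ 0 * x $ 0 + a $ 1 * x $ 1 + a $ 2 * x $ 2 = 0" for x
    proof -
      have "\<forall>j k. (q * x) $ j * image_point q a $ k = (q * x) $ k * image_point q a $ j"
        using zero x unfolding minors_index unfolding image_point_coord vector_mult_component
        by (elim disjE conjE; intro conjI; algebra)
      then show ?thesis
        using that(1) p pt_eq_iff_minors by blast
    qed
    moreover have "pt (image_point q a) \<in> ?T"
      using p unfolding image_point_def
      by (intro CollectI exI[of _ "\<chi> i. a $ (i + 1) - a $ (i + 2)"]) (simp add: index_numerals algebra_simps)
    ultimately show ?thesis by blast
  qed
  then show "pt q \<star>\<^sub>s line a = {pt (image_point q a)}"
    using assms(3) by (simp add: hadamard_set_pt_line zariski_closure_closed zariski_closed_point)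
qed

section \<open>Two points acting on a line\<close>

lemma det_vectors: "det (vector [vector [x, y], vector [z, w]] :: 'a::comm_ring_1^2^2) = x * w - y * z"
  by (simp add: det_2)

theorem theorem3p6:
  fixes a q q' :: "'a::alg_closed_field^3"
    and A Q Q' :: "'a plane" and L :: "'a plane set"
  assumes "a \<noteq> 0" and "A = pt a" and "L = line a"
    and "q \<noteq> 0" and "Q = pt q"
    and "q' \<noteq> 0" and "Q' = pt q'"
    and "Q \<noteq> Q'"
    and "A \<notin> \<Delta> 0" and "Q \<notin> \<Delta> 0" and "Q' \<notin> \<Delta> 0"
  shows
    "(A \<notin> \<Delta> 1 \<and> (Q \<notin> \<Delta> 1 \<or> Q' \<notin> \<Delta> 1) \<longrightarrow>
        is_line (Q \<star>\<^sub>s L) \<and> is_line (Q' \<star>\<^sub>s L) \<and> Q \<star>\<^sub>s L \<noteq> Q' \<star>\<^sub>s L) \<and>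
     (A \<notin> \<Delta> 1 \<and> Q \<in> \<Delta> 1 \<and> Q' \<in> \<Delta> 1 \<longrightarrow>
        is_line (Q \<star>\<^sub>s L) \<and> is_line (Q' \<star>\<^sub>s L) \<and>
        (Q \<star>\<^sub>s L \<noteq> Q' \<star>\<^sub>s L \<longleftrightarrow> Q \<star> Q' \<in> \<Delta> 0)) \<and>
     (A \<in> \<Delta> 1 \<and> Q \<notin> \<Delta> 1 \<and> Q' \<notin> \<Delta> 1 \<longrightarrow>
        is_line (Q \<star>\<^sub>s L) \<and> is_line (Q' \<star>\<^sub>s L) \<and>
        (\<forall>i j k. A \<in> H i \<and> {j, k} = {0, 1, 2} - {i} \<longrightarrow>
          (Q \<star>\<^sub>s L \<noteq> Q' \<star>\<^sub>s L \<longleftrightarrow>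
            det (vector [vector [q $ j, q $ k], vector [q' $ j, q' $ k]] :: 'a^2^2) \<noteq> 0))) \<and>
     (A \<in> \<Delta> 1 \<and> Q' \<notin> \<Delta> 1 \<and> Q \<star> A \<in> \<Delta> 0 \<longrightarrow>
        is_line (Q \<star>\<^sub>s L) \<and> is_line (Q' \<star>\<^sub>s L) \<and> Q \<star>\<^sub>s L \<noteq> Q' \<star>\<^sub>s L) \<and>
     (A \<in> \<Delta> 1 \<and> Q \<star> A \<in> \<Delta> 0 \<and> Q' \<star> A \<in> \<Delta> 0 \<longrightarrow>
        is_line (Q \<star>\<^sub>s L) \<and> is_line (Q' \<star>\<^sub>s L) \<and>
        (Q \<star>\<^sub>s L \<noteq> Q' \<star>\<^sub>s L \<longleftrightarrow> Q \<star> Q' \<in> \<Delta> 0)) \<and>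
     (A \<in> \<Delta> 1 \<and> Q \<in> \<Delta> 1 \<and> Q' \<notin> \<Delta> 1 \<and> Q \<star> A \<notin> \<Delta> 0 \<longrightarrow>
        (\<exists>P. Q \<star>\<^sub>s L = {P} \<and> is_line (Q' \<star>\<^sub>s L) \<and>
          (\<forall>i j k. A \<in> H i \<and> {j, k} = {0, 1, 2} - {i} \<longrightarrow>
            (P \<in> Q' \<star>\<^sub>s L \<longleftrightarrow>
              det (vector [vector [q $ j, q $ k], vector [q' $ j, q' $ k]] :: 'a^2^2) = 0)))) \<and>
     (A \<in> \<Delta> 1 \<and> Q \<in> \<Delta> 1 \<and> Q \<star> A \<notin> \<Delta> 0 \<and> Q' \<star> A \<in> \<Delta> 0 \<longrightarrow>
        (\<exists>P. Q \<star>\<^sub>s L = {P} \<and> is_line (Q' \<star>\<^sub>s L) \<and> P \<notin> Q' \<star>\<^sub>s L)) \<and>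
     (A \<in> \<Delta> 1 \<and> Q \<in> \<Delta> 1 \<and> Q' \<in> \<Delta> 1 \<and> Q \<star> A \<notin> \<Delta> 0 \<and> Q' \<star> A \<notin> \<Delta> 0 \<longrightarrow>
        (\<exists>P P'. Q \<star>\<^sub>s L = {P} \<and> Q' \<star>\<^sub>s L = {P'} \<and> P \<noteq> P'))"
proof -
  note a = \<open>a \<noteq> 0\<close> assms(9)[unfolded assms(2)]
  note q = \<open>q \<noteq> 0\<close> assms(10)[unfolded assms(5)]
  note q' = \<open>q' \<noteq> 0\<close> assms(11)[unfolded assms(7)]
  have Delta1: "A \<in> \<Delta> 1 \<longleftrightarrow> a $ 0 = 0 \<or> a $ 1 = 0 \<or> a $ 2 = 0"
    "Q \<in> \<Delta> 1 \<longleftrightarrow> q $ 0 = 0 \<or> q $ 1 = 0 \<or> q $ 2 = 0"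
    "Q' \<in> \<Delta> 1 \<longleftrightarrow> q' $ 0 = 0 \<or> q' $ 1 = 0 \<or> q' $ 2 = 0"
    unfolding assms(2,5,7) pt_in_Delta1_iff[OF assms(1)] pt_in_Delta1_iff[OF assms(4)]
      pt_in_Delta1_iff[OF assms(6)]
    by simp_all

  have lineQ: "Q \<star>\<^sub>s L = line (image_form q a)" if "image_form q a \<noteq> 0"
    unfolding assms(3,5) by (rule hadamard_line_eq_line[OF that])
  have lineQ': "Q' \<star>\<^sub>s L = line (image_form q' a)" if "image_form q' a \<noteq> 0"
    unfolding assms(3,7) by (rule hadamard_line_eq_line[OF that])
  have is_line: "is_line (Q \<star>\<^sub>s L)" if "image_form q a \<noteq> 0"
    using lineQ that unfolding is_line_def by blast
  have is_line': "is_line (Q' \<star>\<^sub>s L)" if "image_form q' a \<noteq> 0"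
    using lineQ' that unfolding is_line_def by blast
  note image_form = image_form_eq_0_iff[OF a q] and image_form' = image_form_eq_0_iff[OF a q']
  have eq: "Q \<star>\<^sub>s L = Q' \<star>\<^sub>s L \<longleftrightarrow>
    (a $ 1 * a $ 2 * q $ 0 * q' $ 0 = 0 \<or> q $ 1 * q' $ 2 = q $ 2 * q' $ 1) \<and>
    (a $ 0 * a $ 2 * q $ 1 * q' $ 1 = 0 \<or> q $ 0 * q' $ 2 = q $ 2 * q' $ 0) \<and>
    (a $ 0 * a $ 1 * q $ 2 * q' $ 2 = 0 \<or> q $ 0 * q' $ 1 = q $ 1 * q' $ 0)"
    if "image_form q a \<noteq> 0" "image_form q' a \<noteq> 0"
    unfolding lineQ[OF that(1)] lineQ'[OF that(2)] line_eq_iff[OF that] pt_eq_iff_minors[OF that]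
    by (rule image_form_minors)
  have distinct: "\<not> (q $ 1 * q' $ 2 = q $ 2 * q' $ 1 \<and> q $ 0 * q' $ 2 = q $ 2 * q' $ 0 \<and>
      q $ 0 * q' $ 1 = q $ 1 * q' $ 0)"
    using assms(8) unfolding assms(5,7) pt_eq_iff_minors[OF assms(4,6)] minors_index by blast

  note zero_a = unique_zero_coord[OF a, folded assms(2)]
    and zero_q = unique_zero_coord[OF q, folded assms(5)]
    and zero_q' = unique_zero_coord[OF q', folded assms(7)]
  note product_QQ' = hadamard_in_Delta0_iff[OF q q', folded assms(5,7)]
  note product_Q = hadamard_in_Delta0_iff_image_form[OF a _ q, folded assms(2,5)]
    and product_Q' = hadamard_in_Delta0_iff_image_form[OF a _ q', folded assms(2,7)]
  \<comment> \<open>If the lines agree and \<open>q\<close> has no zeros, every index with \<open>q'\<^sub>i \<noteq> 0\<close> makes a minor of \<open>q\<close> and \<open>q'\<close> vanish,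
    and \<open>q'\<close> has at least two such indices; this forces \<open>Q = Q'\<close>.\<close>
  have distinct_lines_A_off: "is_line (Q \<star>\<^sub>s L) \<and> is_line (Q' \<star>\<^sub>s L) \<and> Q \<star>\<^sub>s L \<noteq> Q' \<star>\<^sub>s L"
    if "A \<notin> \<Delta> 1" "Q \<notin> \<Delta> 1 \<or> Q' \<notin> \<Delta> 1"
  proof -
    have t: "image_form q a \<noteq> 0" "image_form q' a \<noteq> 0"
      using that image_form image_form' Delta1 by auto
    show ?thesis
      using is_line is_line' t eq[OF t] that distinct two_nonzero_coords[OF q]
        two_nonzero_coords[OF q'] unfolding Delta1
      by auto
  qed
  \<comment> \<open>The two lines are the coordinate lines through \<open>Q\<close> and \<open>Q'\<close>; they differ when the zeros of
    \<open>q\<close> and \<open>q'\<close> do, which leaves only one nonzero coordinate in the product.\<close>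
  have lines_only_A_off: "is_line (Q \<star>\<^sub>s L) \<and> is_line (Q' \<star>\<^sub>s L) \<and> (Q \<star>\<^sub>s L \<noteq> Q' \<star>\<^sub>s L \<longleftrightarrow> Q \<star> Q' \<in> \<Delta> 0)"
    if "A \<notin> \<Delta> 1" "Q \<in> \<Delta> 1" "Q' \<in> \<Delta> 1"
  proof -
    have t: "image_form q a \<noteq> 0" "image_form q' a \<noteq> 0"
      using that image_form image_form' Delta1 by auto
    have "Q \<star>\<^sub>s L \<noteq> Q' \<star>\<^sub>s L \<longleftrightarrow> Q \<star> Q' \<in> \<Delta> 0"
      using that distinct two_nonzero_coords[OF q] two_nonzero_coords[OF q']
      unfolding Delta1 eq[OF t] product_QQ'
      by auto
    then show ?thesis
      using is_line is_line' t by blast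
  qed
  have H: "A \<in> H i \<longleftrightarrow> a $ i = 0" for i
    unfolding assms(2) by (rule pt_in_coord_line_iff[OF assms(1)])
  \<comment> \<open>With \<open>a\<^sub>i = 0\<close>, only the minor of \<open>q\<close> and \<open>q'\<close> in the columns other than \<open>i\<close> has a nonzero
    monomial in front of it.\<close>
  have lines_only_A_on: "is_line (Q \<star>\<^sub>s L) \<and> is_line (Q' \<star>\<^sub>s L) \<and>
        (\<forall>i j k. A \<in> H i \<and> {j, k} = {0, 1, 2} - {i} \<longrightarrow>
          (Q \<star>\<^sub>s L \<noteq> Q' \<star>\<^sub>s L \<longleftrightarrow>
            det (vector [vector [q $ j, q $ k], vector [q' $ j, q' $ k]] :: 'a^2^2) \<noteq> 0))"
    if "A \<in> \<Delta> 1" "Q \<notin> \<Delta> 1" "Q' \<notin> \<Delta> 1"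
  proof -
    have t: "image_form q a \<noteq> 0" "image_form q' a \<noteq> 0"
      using that image_form image_form' Delta1 by auto
    have "Q \<star>\<^sub>s L = Q' \<star>\<^sub>s L \<longleftrightarrow> q $ j * q' $ k = q $ k * q' $ j"
      if "a $ i = 0" "j \<noteq> i" "k \<noteq> i" "j \<noteq> k" for i j k
      using \<open>Q \<notin> \<Delta> 1\<close> \<open>Q' \<notin> \<Delta> 1\<close> two_nonzero_coords[OF a] that
        index_cases[of i] index_cases[of j] index_cases[of k]
      unfolding Delta1 eq[OF t]
      by auto
    then show ?thesis
      using is_line is_line' t unfolding det_vectors H right_minus_eq
      by (metis complement_index)
  qed
  have pointQ: "Q \<star>\<^sub>s L = {pt (image_point q a)}" "image_point q a \<noteq> 0" if "image_form q a = 0"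
    unfolding assms(3,5)
    using hadamard_line_eq_point[OF a q that]
    by simp_all
  have pointQ': "Q' \<star>\<^sub>s L = {pt (image_point q' a)}" "image_point q' a \<noteq> 0" if "image_form q' a = 0"
    unfolding assms(3,7)
    using hadamard_line_eq_point[OF a q' that]
    by simp_all
  \<comment> \<open>The form of \<open>Q\<close> has one nonzero coefficient, the form of \<open>Q'\<close> has two.\<close>
  have distinct_lines_only_Q'_off: "is_line (Q \<star>\<^sub>s L) \<and> is_line (Q' \<star>\<^sub>s L) \<and> Q \<star>\<^sub>s L \<noteq> Q' \<star>\<^sub>s L"
    if "A \<in> \<Delta> 1" "Q' \<notin> \<Delta> 1" "Q \<star> A \<in> \<Delta> 0"
  proof -
    have Q: "Q \<in> \<Delta> 1" and t: "image_form q a \<noteq> 0" "image_form q' a \<noteq> 0"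
      using that product_Q unfolding image_form' Delta1 by blast+
    have "Q \<star>\<^sub>s L \<noteq> Q' \<star>\<^sub>s L"
      using zero_a[OF that(1)] zero_q[OF Q] that(2) t(1) unfolding Delta1 eq[OF t] image_form
      by (elim disjE conjE) simp_all
    then show ?thesis
      using is_line is_line' t by blast
  qed
  \<comment> \<open>Again both lines are the coordinate lines through \<open>Q\<close> and \<open>Q'\<close>.\<close>
  have lines_zeros_not_at_A: "is_line (Q \<star>\<^sub>s L) \<and> is_line (Q' \<star>\<^sub>s L) \<and> (Q \<star>\<^sub>s L \<noteq> Q' \<star>\<^sub>s L \<longleftrightarrow> Q \<star> Q' \<in> \<Delta> 0)"
    if "A \<in> \<Delta> 1" "Q \<star> A \<in> \<Delta> 0" "Q' \<star> A \<in> \<Delta> 0"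
  proof -
    have Q: "Q \<in> \<Delta> 1" "Q' \<in> \<Delta> 1" and t: "image_form q a \<noteq> 0" "image_form q' a \<noteq> 0"
      using that product_Q product_Q' by blast+
    have "Q \<star>\<^sub>s L \<noteq> Q' \<star>\<^sub>s L \<longleftrightarrow> Q \<star> Q' \<in> \<Delta> 0"
      using zero_a[OF that(1)] zero_q[OF Q(1)] zero_q'[OF Q(2)] t
      unfolding eq[OF t] product_QQ' image_form image_form'
      by (elim disjE conjE) simp_all
    then show ?thesis
      using is_line is_line' t by blast
  qed
  \<comment> \<open>If \<open>a\<^sub>i = 0\<close>, the form of \<open>Q'\<close> takes at the contracted point the value
    \<open>\<plusminus> a\<^sub>j a\<^sub>k q'\<^sub>i (q\<^sub>j q'\<^sub>k - q\<^sub>k q'\<^sub>j)\<close>.\<close>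
  have point_and_line_Q'_off: "\<exists>P. Q \<star>\<^sub>s L = {P} \<and> is_line (Q' \<star>\<^sub>s L) \<and>
          (\<forall>i j k. A \<in> H i \<and> {j, k} = {0, 1, 2} - {i} \<longrightarrow>
            (P \<in> Q' \<star>\<^sub>s L \<longleftrightarrow>
              det (vector [vector [q $ j, q $ k], vector [q' $ j, q' $ k]] :: 'a^2^2) = 0))"
    if "A \<in> \<Delta> 1" "Q \<in> \<Delta> 1" "Q' \<notin> \<Delta> 1" "Q \<star> A \<notin> \<Delta> 0"
  proof -
    have t: "image_form q a = 0"
      using that product_Q by blast
    have t': "image_form q' a \<noteq> 0"
      using that unfolding image_form' Delta1 by blast
    have incident: "pt (image_point q a) \<in> Q' \<star>\<^sub>s L \<longleftrightarrow>
      a $ 0 * q' $ 1 * q' $ 2 * (q $ 0 * (a $ 1 - a $ 2)) +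
      a $ 1 * q' $ 0 * q' $ 2 * (q $ 1 * (a $ 2 - a $ 0)) +
      a $ 2 * q' $ 0 * q' $ 1 * (q $ 2 * (a $ 0 - a $ 1)) = 0"
      unfolding lineQ'[OF t'] pt_in_line_iff[OF pointQ(2)[OF t]] image_form_coord
        image_point_coord ..
    have "pt (image_point q a) \<in> Q' \<star>\<^sub>s L \<longleftrightarrow> q $ j * q' $ k = q $ k * q' $ j"
      if "a $ i = 0" "j \<noteq> i" "k \<noteq> i" "j \<noteq> k" for i j k
    proof -
      have 0: "pt (image_point q a) \<in> Q' \<star>\<^sub>s L \<longleftrightarrow> q $ 1 * q' $ 2 = q $ 2 * q' $ 1" if "a $ 0 = 0"
      proof -
        have "a $ 1 * q' $ 0 * q' $ 2 * (q $ 1 * a $ 2) - a $ 2 * q' $ 0 * q' $ 1 * (q $ 2 * a $ 1) =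
            a $ 1 * a $ 2 * q' $ 0 * (q $ 1 * q' $ 2 - q $ 2 * q' $ 1)"
          by (simp add: algebra_simps)
        then show ?thesis
          using that two_nonzero_coords[OF a] \<open>Q' \<notin> \<Delta> 1\<close> unfolding incident Delta1 by simp
      qed
      have 1: "pt (image_point q a) \<in> Q' \<star>\<^sub>s L \<longleftrightarrow> q $ 0 * q' $ 2 = q $ 2 * q' $ 0" if "a $ 1 = 0"
      proof -
        have "a $ 2 * q' $ 0 * q' $ 1 * (q $ 2 * a $ 0) - a $ 0 * q' $ 1 * q' $ 2 * (q $ 0 * a $ 2) =
            a $ 0 * a $ 2 * q' $ 1 * (q $ 2 * q' $ 0 - q $ 0 * q' $ 2)"
          by (simp add: algebra_simps)
        then show ?thesis
          using that two_nonzero_coords[OF a] \<open>Q' \<notin> \<Delta> 1\<close> unfolding incident Delta1 by auto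
      qed
      have 2: "pt (image_point q a) \<in> Q' \<star>\<^sub>s L \<longleftrightarrow> q $ 0 * q' $ 1 = q $ 1 * q' $ 0" if "a $ 2 = 0"
      proof -
        have "a $ 0 * q' $ 1 * q' $ 2 * (q $ 0 * a $ 1) - a $ 1 * q' $ 0 * q' $ 2 * (q $ 1 * a $ 0) =
            a $ 0 * a $ 1 * q' $ 2 * (q $ 0 * q' $ 1 - q $ 1 * q' $ 0)"
          by (simp add: algebra_simps)
        then show ?thesis
          using that two_nonzero_coords[OF a] \<open>Q' \<notin> \<Delta> 1\<close> unfolding incident Delta1 by simp
      qed
      show ?thesis
        using that 0 1 2 index_cases[of i] index_cases[of j] index_cases[of k]
        by (elim disjE) auto
    qed
    then show ?thesis
      using is_line'[OF t'] pointQ(1)[OF t] unfolding det_vectors H right_minus_eq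
      by (metis complement_index)
  qed
  \<comment> \<open>The contracted point vanishes only where \<open>a\<close> does, whereas the line consists of the points
    that vanish where \<open>q'\<close> does.\<close>
  have point_off_line: "\<exists>P. Q \<star>\<^sub>s L = {P} \<and> is_line (Q' \<star>\<^sub>s L) \<and> P \<notin> Q' \<star>\<^sub>s L"
    if "A \<in> \<Delta> 1" "Q \<in> \<Delta> 1" "Q \<star> A \<notin> \<Delta> 0" "Q' \<star> A \<in> \<Delta> 0"
  proof -
    have t: "image_form q a = 0" and t': "image_form q' a \<noteq> 0" and Q': "Q' \<in> \<Delta> 1"
      using that product_Q product_Q' by blast+
    have "pt (image_point q a) \<notin> Q' \<star>\<^sub>s L"
      using zero_a[OF that(1)] zero_q[OF that(2)] zero_q'[OF Q'] t t'
      unfolding lineQ'[OF t'] pt_in_line_iff[OF pointQ(2)[OF t]] image_form_coord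
        image_point_coord image_form image_form'
      by (elim disjE conjE) simp_all
    then show ?thesis
      using is_line' t' pointQ(1) t by blast
  qed
  \<comment> \<open>All three vectors vanish at the same \<open>i\<close>, so the points of the images are
    \<open>(q\<^sub>j a\<^sub>k, - q\<^sub>k a\<^sub>j)\<close> and \<open>(q'\<^sub>j a\<^sub>k, - q'\<^sub>k a\<^sub>j)\<close> in the other coordinates, and these are
    proportional only if \<open>q\<close> and \<open>q'\<close> are.\<close>
  have distinct_points: "\<exists>P P'. Q \<star>\<^sub>s L = {P} \<and> Q' \<star>\<^sub>s L = {P'} \<and> P \<noteq> P'"
    if "A \<in> \<Delta> 1" "Q \<in> \<Delta> 1" "Q' \<in> \<Delta> 1" "Q \<star> A \<notin> \<Delta> 0" "Q' \<star> A \<notin> \<Delta> 0"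
  proof -
    have t: "image_form q a = 0" "image_form q' a = 0"
      using that product_Q product_Q' by blast+
    have "pt (image_point q a) \<noteq> pt (image_point q' a)"
      using zero_a[OF that(1)] zero_q[OF that(2)] zero_q'[OF that(3)] t distinct
      unfolding pt_eq_iff_minors[OF pointQ(2)[OF t(1)] pointQ'(2)[OF t(2)]] minors_index
        image_point_coord image_form image_form'
      by (elim disjE conjE) (simp_all add: mult.assoc)
    then show ?thesis
      using pointQ pointQ' t by blast
  qed
  show ?thesis
    using distinct_lines_A_off lines_only_A_off lines_only_A_on distinct_lines_only_Q'_off
      lines_zeros_not_at_A point_and_line_Q'_off point_off_line distinct_points
    by simp
qed

end
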